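(* Let $n\ge2$, $m\ge1$, let $\nu=(\nu_1,\dots,\nu_m)$ with all $\nu_a\in\{1,\dots,n-1\}$, let $\mu\in\mathbb C^m$ be generic (that is, $\mu_a-\mu_b\notin\mathbb Z$ whenever $a\neq b$), and put $\lambda=\mu+\nu$. Then the restriction of the operator $B(\mu)$ (defined in the context) to the subspace $\Lambda^{\nu_1}(\mathbb C^n)\otimes\cdots\otimes\Lambda^{\nu_m}(\mathbb C^n)\subset(\mathbb C^n)^{\otimes N}$ coincides with the restriction of the operator $$\prod_{1\le a<b\le m}^{\longrightarrow}\Bigl(1+\sum_{d>0}\ \sum_{\substack{i_1,\dots,i_d\\ j_1,\dots,j_d}}\ \prod_{k=1}^d\frac{P_{i_kj_k}}{\lambda_a-\lambda_b+\rho_a-\rho_b+\nu_b-k}\Bigr),$$ where the factors are arranged from left to right in the lexicographic order of the pairs $(a,b)$, and for each $(a,b)$ and $d$ the inner sum is over all different sets of $d$ pairs $\{(i_1,j_1),\dots,(i_d,j_d)\}$ with $i_1,\dots,i_d$ pairwise distinct numbers from the $a$th segment and $j_1,\dots,j_d$ pairwise distinct numbers from the $b$th segment of the sequence $1,\dots,N$ (each such set being counted once).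
   Context: $\rho_a=m/2-a+1/2$ for $a=1,\dots,m$. Put $N=\nu_1+\dots+\nu_m$ and split $1,\dots,N$ into consecutive segments of lengths $\nu_1,\dots,\nu_m$. For the $i$th element $p=\nu_1+\dots+\nu_{a-1}+i$ ($1\le i\le\nu_a$) of the $a$th segment put $x_p=\mu_a+\rho_a+\frac12+\nu_a-i$. Let $1'',\dots,N''$ be the sequence obtained from $1,\dots,N$ by reversing the order within each segment while keeping the order of the segments. Let $P$ be the flip on $\mathbb C^n\otimes\mathbb C^n$ and $R(x)=1-P\,x^{-1}$; $P_{pq}$, $R_{pq}(x)$ denote these operators acting in the $p$th and $q$th tensor factors of $(\mathbb C^n)^{\otimes N}$. Put $$B(\mu)=\prod_{(p,q)}^{\longrightarrow}R_{pq}(x_q-x_p),$$ the product over pairs $p<q$ belonging to different segments, arranged from left to right so that $(p,q)$ precedes $(r,s)$ if $p<r$, or if $p=r$ and $q$ precedes $s$ in the sequence $1'',\dots,N''$. The subspace $\Lambda^{\nu_1}(\mathbb C^n)\otimes\cdots\otimes\Lambda^{\nu_m}(\mathbb C^n)$ consists of tensors antisymmetric within each segment. *)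

theory Defs
  imports "HOL-Analysis.Analysis" "HOL-Combinatorics.Transposition"
begin

text \<open>
  The space \<open>C^n\<close> has a basis indexed by the finite type \<open>'n\<close>, so that \<open>n = CARD('n)\<close>.
  An element of its \<open>N\<close>th tensor power is given by its coordinates in the tensor product basis,
  hence by a function of the multi-index \<open>I\<close>, which assigns a basis index to each of the tensor
  factors \<open>1, \<dots>, N\<close>.  The decomposable tensor \<open>v 1 \<otimes> \<dots> \<otimes> v N\<close> is
  \<open>\<lambda>I. \<Prod>p=1..N. v p $ I p\<close> on multi-indices.  All sequences \<open>\<nu>\<close>, \<open>\<mu>\<close>, \<open>\<lambda>\<close> are indexed
  from \<open>1\<close> to \<open>m\<close>.
\<close>

type_synonym 'n tensor = "(nat \<Rightarrow> 'n) \<Rightarrow> complex"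

definition multi_indices :: "nat \<Rightarrow> (nat \<Rightarrow> 'n) set" where
  "multi_indices N = ({1..N} \<rightarrow>\<^sub>E UNIV)"

definition tensor_power :: "nat \<Rightarrow> 'n tensor set" where
  "tensor_power N = {T. \<forall>I. I \<notin> multi_indices N \<longrightarrow> T I = 0}"

text \<open>
  Operators on the tensor square are matrices indexed by pairs; the flip sends
  \<open>e\<^sub>k \<otimes> e\<^sub>l\<close> to \<open>e\<^sub>l \<otimes> e\<^sub>k\<close>.  Note that \<open>mat c\<close> is the scalar matrix \<open>c\<close>.
\<close>

definition flip :: "complex ^ ('n::finite \<times> 'n) ^ ('n \<times> 'n)" where
  "flip = (\<chi> r s. if r = prod.swap s then 1 else 0)"

definition R_matrix :: "complex \<Rightarrow> complex ^ ('n::finite \<times> 'n) ^ ('n \<times> 'n)" where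
  "R_matrix x = mat 1 - flip ** mat (inverse x)"

text \<open>The operator \<open>A\<close> acting in the \<open>p\<close>th and \<open>q\<close>th tensor factors, for \<open>p \<noteq> q\<close>.\<close>

definition act_in ::
    "nat \<Rightarrow> nat \<Rightarrow> complex ^ ('n::finite \<times> 'n) ^ ('n \<times> 'n) \<Rightarrow> 'n tensor \<Rightarrow> 'n tensor" where
  "act_in p q A T =
     (\<lambda>I. \<Sum>k\<in>UNIV. \<Sum>l\<in>UNIV. A $ (I p, I q) $ (k, l) * T (I(p := k, q := l)))"

lemma act_in_flip:
  assumes "p \<noteq> q"
  shows "act_in p q flip T = (\<lambda>I. T (I \<circ> Transposition.transpose p q))"
proof
  fix I
  have "act_in p q flip T I =
      (\<Sum>k\<in>UNIV. \<Sum>l\<in>UNIV. if l = I p then (if k = I q then T (I(p := k, q := l)) else 0) else 0)"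
    unfolding act_in_def flip_def by (intro sum.cong) auto
  also have "\<dots> = T (I(p := I q, q := I p))"
    by simp
  also have "I(p := I q, q := I p) = I \<circ> Transposition.transpose p q"
    using assms by (auto simp: Transposition.transpose_def fun_eq_iff)
  finally show "act_in p q flip T I = T (I \<circ> Transposition.transpose p q)" .
qed

definition segment_list :: "(nat \<Rightarrow> nat) \<Rightarrow> nat \<Rightarrow> nat list" where
  "segment_list \<nu> a = [Suc (\<Sum>c=1..<a. \<nu> c)..<Suc (\<Sum>c=1..a. \<nu> c)]"

abbreviation segment :: "(nat \<Rightarrow> nat) \<Rightarrow> nat \<Rightarrow> nat set" where
  "segment \<nu> a \<equiv> set (segment_list \<nu> a)"

definition total :: "nat \<Rightarrow> (nat \<Rightarrow> nat) \<Rightarrow> nat" where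
  "total m \<nu> = (\<Sum>c=1..m. \<nu> c)"

definition segment_of :: "(nat \<Rightarrow> nat) \<Rightarrow> nat \<Rightarrow> nat" where
  "segment_of \<nu> p = (LEAST a. p \<le> (\<Sum>c=1..a. \<nu> c))"

definition position_in_segment :: "(nat \<Rightarrow> nat) \<Rightarrow> nat \<Rightarrow> nat" where
  "position_in_segment \<nu> p = p - (\<Sum>c=1..<segment_of \<nu> p. \<nu> c)"

text \<open>The sequence \<open>1'', \<dots>, N''\<close>.\<close>

definition reversed_within_segments :: "nat \<Rightarrow> (nat \<Rightarrow> nat) \<Rightarrow> nat list" where
  "reversed_within_segments m \<nu> = concat (map (\<lambda>a. rev (segment_list \<nu> a)) [1..<Suc m])"

definition rho :: "nat \<Rightarrow> nat \<Rightarrow> complex" where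
  "rho m a = of_nat m / 2 - of_nat a + 1 / 2"

definition x_coord :: "nat \<Rightarrow> (nat \<Rightarrow> nat) \<Rightarrow> (nat \<Rightarrow> complex) \<Rightarrow> nat \<Rightarrow> complex" where
  "x_coord m \<nu> \<mu> p =
     (let a = segment_of \<nu> p; i = position_in_segment \<nu> p
      in \<mu> a + rho m a + 1 / 2 + of_nat (\<nu> a) - of_nat i)"

text \<open>
  In an ordered product of operators the leftmost factor is the head of the list, and is
  applied last.
\<close>

definition ordered_prod :: "('a \<Rightarrow> 'v \<Rightarrow> 'v) \<Rightarrow> 'a list \<Rightarrow> 'v \<Rightarrow> 'v" where
  "ordered_prod F xs = foldr (\<lambda>x G. F x \<circ> G) xs id"

definition B_pairs :: "nat \<Rightarrow> (nat \<Rightarrow> nat) \<Rightarrow> (nat \<times> nat) list" where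
  "B_pairs m \<nu> =
     [(p, q). p \<leftarrow> [1..<Suc (total m \<nu>)], q \<leftarrow> reversed_within_segments m \<nu>,
              p < q \<and> segment_of \<nu> p \<noteq> segment_of \<nu> q]"

definition B_op ::
    "nat \<Rightarrow> (nat \<Rightarrow> nat) \<Rightarrow> (nat \<Rightarrow> complex) \<Rightarrow> 'n::finite tensor \<Rightarrow> 'n tensor" where
  "B_op m \<nu> \<mu> =
     ordered_prod (\<lambda>(p, q). act_in p q (R_matrix (x_coord m \<nu> \<mu> q - x_coord m \<nu> \<mu> p)))
       (B_pairs m \<nu>)"

definition antisymmetric_tensors :: "nat \<Rightarrow> (nat \<Rightarrow> nat) \<Rightarrow> 'n::finite tensor set" where
  "antisymmetric_tensors m \<nu> =
     {T \<in> tensor_power (total m \<nu>).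
        \<forall>a\<in>{1..m}. \<forall>p\<in>segment \<nu> a. \<forall>q\<in>segment \<nu> a. p \<noteq> q \<longrightarrow> act_in p q flip T = (\<lambda>I. - T I)}"

definition pair_sets :: "(nat \<Rightarrow> nat) \<Rightarrow> nat \<Rightarrow> nat \<Rightarrow> nat \<Rightarrow> (nat \<times> nat) set set" where
  "pair_sets \<nu> a b d =
     {S. S \<subseteq> segment \<nu> a \<times> segment \<nu> b \<and> card S = d \<and> inj_on fst S \<and> inj_on snd S}"

text \<open>
  The product of the operators \<open>P\<^sub>i\<^sub>j\<close> over a set \<open>S\<close> of pairs is taken in no particular order;
  the factors commute by the lemma following the definition.
\<close>

definition flip_prod :: "(nat \<times> nat) set \<Rightarrow> 'n::finite tensor \<Rightarrow> 'n tensor" where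
  "flip_prod S T = Finite_Set.fold (\<lambda>(i, j). act_in i j flip) T S"

lemma comp_fun_commute_on_flip:
  assumes "a < b" "S \<in> pair_sets \<nu> a b d"
  shows "comp_fun_commute_on S
           (\<lambda>(i, j). act_in i j (flip :: complex ^ ('n::finite \<times> 'n) ^ ('n \<times> 'n)))"
proof -
  have "(\<Sum>c=1..a. \<nu> c) \<le> (\<Sum>c=1..<b. \<nu> c)"
    using assms(1) by (intro sum_mono2) auto
  then have disj: "i < j" if "i \<in> segment \<nu> a" "j \<in> segment \<nu> b" for i j
    using that by (auto simp: segment_list_def)
  show ?thesis
  proof (unfold_locales, clarify)
    fix i j k l
    assume ij: "(i, j) \<in> S" and kl: "(k, l) \<in> S"
    have S: "S \<subseteq> segment \<nu> a \<times> segment \<nu> b" "inj_on fst S" "inj_on snd S"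
      using assms(2) by (auto simp: pair_sets_def)
    have lt: "i < j" "k < l" "i < l" "k < j"
      using ij kl S(1) disj by auto
    have eq: "i = k \<longleftrightarrow> j = l"
      using inj_onD[OF S(2) _ ij kl] inj_onD[OF S(3) _ ij kl] by auto
    have "Transposition.transpose i j \<circ> Transposition.transpose k l =
          Transposition.transpose k l \<circ> Transposition.transpose i j"
      using lt eq by (auto simp: fun_eq_iff Transposition.transpose_def)
    then have comm: "I \<circ> Transposition.transpose k l \<circ> Transposition.transpose i j =
               I \<circ> Transposition.transpose i j \<circ> Transposition.transpose k l" for I :: "nat \<Rightarrow> 'n"
      by (simp add: comp_assoc)
    show "act_in k l flip \<circ> act_in i j flip =
               act_in i j flip \<circ> (act_in k l flip :: 'n tensor \<Rightarrow> 'n tensor)"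
      using lt by (simp add: act_in_flip fun_eq_iff comm)
  qed
qed

text \<open>
  The sum over all \<open>d > 0\<close> stops at \<open>min (\<nu> a) (\<nu> b)\<close>, since there are no sets of pairs for
  larger \<open>d\<close>.
\<close>

lemma pair_sets_empty:
  assumes "a \<ge> 1" "b \<ge> 1" "d > min (\<nu> a) (\<nu> b)"
  shows "pair_sets \<nu> a b d = {}"
proof -
  have card: "card (segment \<nu> c) = \<nu> c" if "c \<ge> 1" for c
    using that sum.last_plus[of 1 c \<nu>] by (simp add: segment_list_def del: upt_Suc)
  have "d \<le> min (\<nu> a) (\<nu> b)" if "S \<in> pair_sets \<nu> a b d" for S
  proof -
    have "card (fst ` S) = d" "card (snd ` S) = d"
      using that by (auto simp: pair_sets_def card_image)
    moreover have "fst ` S \<subseteq> segment \<nu> a" "snd ` S \<subseteq> segment \<nu> b"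
      using that by (auto simp: pair_sets_def)
    ultimately show ?thesis
      using card_mono[of "segment \<nu> a" "fst ` S"] card_mono[of "segment \<nu> b" "snd ` S"]
        card[OF assms(1)] card[OF assms(2)] by auto
  qed
  then show ?thesis
    using assms(3) by fastforce
qed

definition pair_factor ::
    "nat \<Rightarrow> (nat \<Rightarrow> nat) \<Rightarrow> (nat \<Rightarrow> complex) \<Rightarrow> nat \<Rightarrow> nat \<Rightarrow> 'n::finite tensor \<Rightarrow> 'n tensor" where
  "pair_factor m \<nu> lam a b T =
     (\<lambda>I. T I + (\<Sum>d=1..min (\<nu> a) (\<nu> b). \<Sum>S\<in>pair_sets \<nu> a b d.
        (\<Prod>k=1..d. 1 / (lam a - lam b + rho m a - rho m b + of_nat (\<nu> b) - of_nat k)) *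
        flip_prod S T I))"

definition lex_pairs :: "nat \<Rightarrow> (nat \<times> nat) list" where
  "lex_pairs m = [(a, b). a \<leftarrow> [1..<Suc m], b \<leftarrow> [Suc a..<Suc m]]"

end

theory Submission
  imports Defs
begin

text \<open>
  Factors \<open>R\<^sub>p\<^sub>q\<close>, \<open>R\<^sub>r\<^sub>s\<close> with disjoint index pairs commute, so \<open>B(\<mu>)\<close> regroups into blocks, one for each
  pair of segments \<open>a < b\<close> in lexicographic order.  In a block \<open>x\<^sub>q - x\<^sub>p = - (d + q)\<close> with \<open>d\<close> depending
  only on \<open>p\<close>, and on tensors antisymmetric in the segment \<open>b\<close> the identity
  \<open>P\<^sub>p\<^sub>q P\<^sub>p\<^sub>r = P\<^sub>p\<^sub>r P\<^sub>r\<^sub>q\<close> makes the product over \<open>q\<close> telescope to \<open>1 + (\<Sum>\<^sub>q P\<^sub>p\<^sub>q) / (c - p)\<close>, \<open>c\<close> independent of \<open>p\<close>.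
  Multiplying these over \<open>p\<close>, from the last index of the segment \<open>a\<close> down, produces the sum over partial
  matchings: if \<open>q\<close> is already matched in \<open>S\<close>, then antisymmetry in the segment \<open>a\<close> turns
  \<open>P\<^sub>p\<^sub>q\<close> times the product of the flips in \<open>S\<close> into minus that product, and otherwise \<open>S\<close> grows by
  \<open>(p, q)\<close>.  The sum over matchings commutes with permutations inside each segment, so antisymmetry
  survives from one block to the next.
\<close>

abbreviation swp :: "nat \<Rightarrow> nat \<Rightarrow> nat \<Rightarrow> nat" where
  "swp \<equiv> Transposition.transpose"

section \<open>Ordered products\<close>

lemma ordered_prod_Nil [simp]: "ordered_prod F [] = id"
  and ordered_prod_Cons [simp]: "ordered_prod F (x # xs) = F x \<circ> ordered_prod F xs"
  by (simp_all add: ordered_prod_def)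

lemma ordered_prod_append [simp]:
  "ordered_prod F (xs @ ys) = ordered_prod F xs \<circ> ordered_prod F ys"
  by (induction xs) (simp_all add: comp_assoc)

lemma ordered_prod_concat_map:
  "ordered_prod F (concat (map f xs)) = ordered_prod (\<lambda>x. ordered_prod F (f x)) xs"
  by (induction xs) simp_all

lemma ordered_prod_map: "ordered_prod F (map f xs) = ordered_prod (\<lambda>x. F (f x)) xs"
  by (induction xs) simp_all

lemma ordered_prod_cong:
  assumes "\<And>x. x \<in> set xs \<Longrightarrow> F x = G x"
  shows "ordered_prod F xs = ordered_prod G xs"
  using assms by (induction xs) simp_all

text \<open>\<open>Q\<close> plays the part of an invariant subspace: the two families are compared
  only on it, and it is handed on from the tail, which is applied first.\<close>

lemma ordered_prod_cong_invariant:
  assumes "\<And>x v. x \<in> set xs \<Longrightarrow> Q v \<Longrightarrow> F x v = G x v"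
    and "\<And>x v. x \<in> set xs \<Longrightarrow> Q v \<Longrightarrow> Q (G x v)"
    and "Q v"
  shows "ordered_prod F xs v = ordered_prod G xs v"
proof -
  have "ordered_prod F xs v = ordered_prod G xs v \<and> Q (ordered_prod G xs v)"
    using assms by (induction xs) auto
  then show ?thesis ..
qed

lemma ordered_prod_commute:
  assumes "\<And>x. x \<in> set xs \<Longrightarrow> F x \<circ> g = g \<circ> F x"
  shows "ordered_prod F xs \<circ> g = g \<circ> ordered_prod F xs"
  using assms
proof (induction xs)
  case (Cons x xs)
  have "F x \<circ> (ordered_prod F xs \<circ> g) = F x \<circ> g \<circ> ordered_prod F xs"
    using Cons.IH [OF Cons.prems [OF list.set_intros(2)]] by (simp only: comp_assoc)
  also have "\<dots> = g \<circ> F x \<circ> ordered_prod F xs"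
    unfolding Cons.prems [OF list.set_intros(1)] ..
  finally show ?case
    by (simp only: ordered_prod_Cons comp_assoc)
qed simp

text \<open>Each \<open>H b\<close> moves left past the factors \<open>F b'\<close> of the tail;
  distinctness ensures \<open>b' \<noteq> b\<close>, and \<open>F b\<close>, \<open>H b\<close> keep
  their mutual order.\<close>

lemma ordered_prod_comp:
  assumes "distinct ys"
    and "\<And>b b'. b \<in> set ys \<Longrightarrow> b' \<in> set ys \<Longrightarrow> b \<noteq> b' \<Longrightarrow> F b \<circ> H b' = H b' \<circ> F b"
  shows "ordered_prod F ys \<circ> ordered_prod H ys = ordered_prod (\<lambda>b. F b \<circ> H b) ys"
  using assms
proof (induction ys)
  case (Cons b ys)
  have "ordered_prod F ys \<circ> H b = H b \<circ> ordered_prod F ys"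
    by (intro ordered_prod_commute Cons.prems(2)) (use Cons.prems(1) in auto)
  then have "F b \<circ> (ordered_prod F ys \<circ> H b) \<circ> ordered_prod H ys =
      F b \<circ> H b \<circ> (ordered_prod F ys \<circ> ordered_prod H ys)"
    by (simp add: comp_assoc)
  moreover have "ordered_prod F ys \<circ> ordered_prod H ys = ordered_prod (\<lambda>b. F b \<circ> H b) ys"
    by (intro Cons.IH Cons.prems(2)) (use Cons.prems(1) in auto)
  ultimately show ?case
    by (simp only: ordered_prod_Cons comp_assoc)
qed simp

text \<open>Two factors of the grid change their order only if they differ in both coordinates, so
  factors sharing \<open>p\<close> or \<open>b\<close> may fail to commute.\<close>

lemma ordered_prod_swap:
  assumes "distinct xs" "distinct ys"
    and "\<And>p p' b b'. p \<in> set xs \<Longrightarrow> p' \<in> set xs \<Longrightarrow> b \<in> set ys \<Longrightarrow> b' \<in> set ys \<Longrightarrow>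
           p \<noteq> p' \<Longrightarrow> b \<noteq> b' \<Longrightarrow> G p b \<circ> G p' b' = G p' b' \<circ> G p b"
  shows "ordered_prod (\<lambda>p. ordered_prod (G p) ys) xs =
         ordered_prod (\<lambda>b. ordered_prod (\<lambda>p. G p b) xs) ys"
  using assms
proof (induction xs)
  case Nil
  show ?case by (induction ys) simp_all
next
  case (Cons p xs)
  have "G p b \<circ> ordered_prod (\<lambda>p. G p b') xs = ordered_prod (\<lambda>p. G p b') xs \<circ> G p b"
    if "b \<in> set ys" "b' \<in> set ys" "b \<noteq> b'" for b b'
    by (intro ordered_prod_commute [symmetric] Cons.prems(3)) (use that Cons.prems(1) in auto)
  then have "ordered_prod (G p) ys \<circ> ordered_prod (\<lambda>b. ordered_prod (\<lambda>p. G p b) xs) ys =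
      ordered_prod (\<lambda>b. G p b \<circ> ordered_prod (\<lambda>p. G p b) xs) ys"
    using Cons.prems(2) by (intro ordered_prod_comp) auto
  moreover have "ordered_prod (\<lambda>p. ordered_prod (G p) ys) xs =
      ordered_prod (\<lambda>b. ordered_prod (\<lambda>p. G p b) xs) ys"
    using Cons.prems by (intro Cons.IH) auto
  ultimately show ?case
    by (simp only: ordered_prod_Cons)
qed

section \<open>The R-matrix and antisymmetry\<close>

lemma act_in_R_matrix:
  assumes "p \<noteq> q"
  shows "act_in p q (R_matrix x) T = (\<lambda>I. T I - T (I \<circ> swp p q) / x)"
proof
  fix I
  have entry: "R_matrix x $ r $ s = (if r = s then 1 else 0) - inverse x * flip $ r $ s" for r s :: "'a \<times> 'a"
    by (simp add: R_matrix_def matrix_matrix_mult_def mat_def if_distrib cong: if_cong)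
  have "act_in p q (R_matrix x) T I =
      (\<Sum>k\<in>UNIV. \<Sum>l\<in>UNIV. (if (I p, I q) = (k, l) then 1 else 0) * T (I(p := k, q := l)))
      - inverse x * act_in p q flip T I"
    by (simp add: act_in_def entry left_diff_distrib sum_subtractf sum_distrib_left mult.assoc)
  also have "(\<Sum>k\<in>UNIV. \<Sum>l\<in>UNIV. (if (I p, I q) = (k, l) then 1 else 0) * T (I(p := k, q := l)))
      = (\<Sum>k\<in>UNIV. \<Sum>l\<in>UNIV. if l = I q then (if k = I p then T (I(p := k, q := l)) else 0) else 0)"
    by (intro sum.cong) auto
  also have "\<dots> = T I"
    by simp
  finally show "act_in p q (R_matrix x) T I = T I - T (I \<circ> swp p q) / x"
    by (simp add: act_in_flip [OF assms] divide_inverse mult.commute)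
qed

lemma act_in_R_matrix_commute:
  assumes "p \<noteq> q" "r \<noteq> s" "p \<noteq> r" "p \<noteq> s" "q \<noteq> r" "q \<noteq> s"
  shows "act_in p q (R_matrix x) \<circ> act_in r s (R_matrix y) =
         act_in r s (R_matrix y) \<circ> act_in p q (R_matrix x)"
proof -
  have "swp p q \<circ> swp r s = swp r s \<circ> swp p q"
    using assms by (auto simp: fun_eq_iff Transposition.transpose_def)
  then show ?thesis
    using assms by (intro ext) (simp add: act_in_R_matrix comp_assoc algebra_simps diff_divide_distrib)
qed

text \<open>Antisymmetry is localised to one set of positions, so that it applies to a single
  segment and, inside inductions, to part of one.\<close>

definition antisymmetric_in :: "nat set \<Rightarrow> 'n tensor \<Rightarrow> bool" where
  "antisymmetric_in A T \<longleftrightarrow>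
     (\<forall>p\<in>A. \<forall>q\<in>A. p \<noteq> q \<longrightarrow> (\<forall>I. T (I \<circ> swp p q) = - T I))"

lemma antisymmetric_inD:
  "antisymmetric_in A T \<Longrightarrow> p \<in> A \<Longrightarrow> q \<in> A \<Longrightarrow> p \<noteq> q \<Longrightarrow> T (I \<circ> swp p q) = - T I"
  by (auto simp: antisymmetric_in_def)

section \<open>One row of a block\<close>

lemma swp_comp_left: "p \<noteq> q \<Longrightarrow> p \<noteq> t \<Longrightarrow> q \<noteq> t \<Longrightarrow> swp p t \<circ> swp p q = swp p q \<circ> swp q t"
  by (auto simp: fun_eq_iff Transposition.transpose_def)

lemma swp_comp_bij: "bij f \<Longrightarrow> f \<circ> swp p q = swp (f p) (f q) \<circ> f"
  by (auto simp: fun_eq_iff Transposition.transpose_def bij_def inj_eq)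

text \<open>Induction on the upper end: as the list is reversed, the new index \<open>e\<close>
  gives the leftmost factor, applied last. With \<open>w = d + e\<close>, antisymmetry turns its
  cross terms with the old sum into \<open>- 1/w\<close> times that sum, whose coefficient drops
  from \<open>1/(w - 1)\<close> to \<open>1/w\<close>.\<close>

lemma row_product:
  assumes "antisymmetric_in {t..<e} T" "p \<notin> {t..<e}" "d \<notin> \<int>" "t \<le> e"
  shows "ordered_prod (\<lambda>q. act_in p q (R_matrix (- (d + of_nat q)))) (rev [t..<e]) T =
         (\<lambda>I. T I + (\<Sum>q\<in>{t..<e}. T (I \<circ> swp p q)) / (d + of_nat e - 1))"
  using assms(4,1,2)
proof (induction e rule: dec_induct)
  case base
  then show ?case by simp
next
  case (step e)
  \<comment> \<open>These are the denominators of the new factor and of the induction hypothesis;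
    neither vanishes as \<open>d\<close> is not an integer.\<close>
  have nz: "d + of_nat e \<noteq> 0" "d + of_nat e - 1 \<noteq> 0"
  proof -
    have "d + of_int k \<noteq> 0" for k
      using assms(3) by (metis Ints_of_int add_eq_0_iff2 of_int_minus)
    from this[of "int e"] this[of "int e - 1"]
    show "d + of_nat e \<noteq> 0" "d + of_nat e - 1 \<noteq> 0"
      by (simp_all add: algebra_simps)
  qed
  define G where "G = (\<lambda>I. T I + (\<Sum>q\<in>{t..<e}. T (I \<circ> swp p q)) / (d + of_nat e - 1))"
  have pe: "p \<noteq> e" using step by auto
  have IH: "ordered_prod (\<lambda>q. act_in p q (R_matrix (- (d + of_nat q)))) (rev [t..<e]) T = G"
    unfolding G_def using step by (intro step.IH) (auto simp: antisymmetric_in_def)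
  have G: "G (I \<circ> swp p e) =
      T (I \<circ> swp p e) - (\<Sum>q\<in>{t..<e}. T (I \<circ> swp p q)) / (d + of_nat e - 1)" for I
  proof -
    have "T (I \<circ> swp p e \<circ> swp p q) = - T (I \<circ> swp p q)" if "q \<in> {t..<e}" for q
    proof -
      \<comment> \<open>Conjugation moves one flip to the pair \<open>q\<close>, \<open>e\<close>,
        which lies inside the antisymmetric interval.\<close>
      have "I \<circ> swp p e \<circ> swp p q = I \<circ> swp p q \<circ> swp q e"
        unfolding comp_assoc using that step.prems(2) pe by (subst swp_comp_left) auto
      moreover have "T (I \<circ> swp p q \<circ> swp q e) = - T (I \<circ> swp p q)"
        by (rule antisymmetric_inD[OF step.prems(1)]) (use that in auto)
      ultimately show ?thesis by (simp only:)
    qed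
    then have "(\<Sum>q\<in>{t..<e}. T (I \<circ> swp p e \<circ> swp p q)) = (\<Sum>q\<in>{t..<e}. - T (I \<circ> swp p q))"
      by (intro sum.cong) auto
    then show ?thesis by (simp add: G_def sum_negf)
  qed
  have "G I + G (I \<circ> swp p e) / (d + of_nat e) =
      T I + (\<Sum>q\<in>{t..<Suc e}. T (I \<circ> swp p q)) / (d + of_nat (Suc e) - 1)" for I
  proof -
    have alg: "x + s / (w - 1) + (y - s / (w - 1)) / w = x + (s + y) / w"
      if "w \<noteq> 0" "w - 1 \<noteq> 0" for x y s w :: complex
    proof -
      have s: "s / (w - 1) - s / (w - 1) / w = s / w"
        using that by (simp add: divide_simps) (simp add: algebra_simps)
      show ?thesis
        unfolding add_divide_distrib diff_divide_distrib s [symmetric] by simp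
    qed
    show ?thesis
      unfolding G using step.hyps alg[OF nz] by (simp add: G_def)
  qed
  then have "(\<lambda>I. G I + G (I \<circ> swp p e) / (d + of_nat e)) =
      (\<lambda>I. T I + (\<Sum>q\<in>{t..<Suc e}. T (I \<circ> swp p q)) / (d + of_nat (Suc e) - 1))"
    by (rule ext)
  moreover have "ordered_prod (\<lambda>q. act_in p q (R_matrix (- (d + of_nat q)))) (rev [t..<Suc e]) T =
      act_in p e (R_matrix (- (d + of_nat e))) G"
    using step.hyps IH by simp
  moreover have "\<dots> = (\<lambda>I. G I + G (I \<circ> swp p e) / (d + of_nat e))"
    unfolding act_in_R_matrix[OF pe] minus_divide_right [symmetric] by simp
  ultimately show ?case by (simp only:)
qed

text \<open>The value of \<open>row_product\<close>, with \<open>c = d + e - 1 + p\<close> the same for all \<open>p\<close> in a segment.\<close>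

definition jucys_row :: "nat set \<Rightarrow> complex \<Rightarrow> nat \<Rightarrow> 'n tensor \<Rightarrow> 'n tensor" where
  "jucys_row B c p T = (\<lambda>I. T I + (\<Sum>q\<in>B. T (I \<circ> swp p q)) / (c - of_nat p))"

lemma swp_bij_betw: "p \<in> A \<Longrightarrow> q \<in> A \<Longrightarrow> bij_betw (swp p q) A A"
  by (rule bij_betw_byWitness[where f' = "swp p q"])
    (auto simp: Transposition.transpose_def)

text \<open>Conjugation by \<open>swp s t\<close> fixes \<open>p\<close> and permutes the flips
  \<open>swp p q\<close> with \<open>q \<in> B\<close> among themselves. This allows rows with
  different \<open>p\<close> to be applied in succession.\<close>

lemma antisymmetric_in_jucys_row:
  assumes "antisymmetric_in B T" "p \<notin> B"
  shows "antisymmetric_in B (jucys_row B c p T)"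
  unfolding antisymmetric_in_def
proof (intro ballI impI allI)
  fix s t I assume st: "s \<in> B" "t \<in> B" "s \<noteq> t"
  have "(\<Sum>q\<in>B. T (I \<circ> swp s t \<circ> swp p q)) = (\<Sum>q\<in>B. - T (I \<circ> swp p (swp s t q)))"
  proof (rule sum.cong)
    fix q assume "q \<in> B"
    have "swp s t p = p" using st assms(2) by (auto simp: Transposition.transpose_def)
    then have "swp s t \<circ> swp p q = swp p (swp s t q) \<circ> swp s t"
      using swp_comp_bij[of "swp s t" p q] by simp
    then have "I \<circ> swp s t \<circ> swp p q = I \<circ> swp p (swp s t q) \<circ> swp s t"
      by (simp only: comp_assoc)
    then show "T (I \<circ> swp s t \<circ> swp p q) = - T (I \<circ> swp p (swp s t q))"
      using antisymmetric_inD[OF assms(1) st] by simp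
  qed simp
  also have "\<dots> = (\<Sum>q\<in>B. - T (I \<circ> swp p q))"
    by (rule sum.reindex_bij_betw[OF swp_bij_betw[OF st(1,2)]])
  finally show "jucys_row B c p T (I \<circ> swp s t) = - jucys_row B c p T I"
    using antisymmetric_inD[OF assms(1) st] by (simp add: jucys_row_def sum_negf)
qed

section \<open>Sums over partial matchings\<close>

definition matchings :: "nat set \<Rightarrow> nat set \<Rightarrow> (nat \<times> nat) set set" where
  "matchings A B = {S. S \<subseteq> A \<times> B \<and> inj_on fst S \<and> inj_on snd S}"

lemma finite_matchings: "finite A \<Longrightarrow> finite B \<Longrightarrow> finite (matchings A B)"
  by (rule finite_subset[of _ "Pow (A \<times> B)"]) (auto simp: matchings_def)

lemma matchings_subset: "S \<in> matchings A B \<Longrightarrow> S' \<subseteq> S \<Longrightarrow> S' \<in> matchings A B"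
  by (auto simp: matchings_def intro: inj_on_subset)

lemma matchings_finite: "S \<in> matchings A B \<Longrightarrow> finite A \<Longrightarrow> finite B \<Longrightarrow> finite S"
  by (auto simp: matchings_def intro: finite_subset[of _ "A \<times> B"])

lemma matchings_empty_left: "matchings {} B = {{}}"
  by (auto simp: matchings_def)

section \<open>Products of flips along a matching\<close>

lemma flip_prod_empty [simp]: "flip_prod {} T = T"
  by (simp add: flip_prod_def)

text \<open>Distinct pairs of a matching have no index in common, so their flips commute and any
  chosen pair may be applied last.\<close>

lemma flip_prod_insert:
  assumes "insert (i, j) S \<in> matchings A B" "(i, j) \<notin> S" "A \<inter> B = {}" "finite S"
  shows "flip_prod (insert (i, j) S) T = (\<lambda>I. flip_prod S T (I \<circ> swp i j))"
proof -
  let ?S = "insert (i, j) S"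
  have S: "?S \<subseteq> A \<times> B" "inj_on fst ?S" "inj_on snd ?S"
    using assms(1) by (auto simp: matchings_def)
  interpret comp_fun_commute_on ?S
    "\<lambda>(i, j). act_in i j (flip :: complex ^ ('a::finite \<times> 'a) ^ ('a \<times> 'a))"
  proof (unfold_locales, clarify)
    fix i1 j1 k l
    assume ij: "(i1, j1) \<in> ?S" and kl: "(k, l) \<in> ?S"
    have ne: "i1 \<noteq> j1" "k \<noteq> l" "i1 \<noteq> l" "k \<noteq> j1"
      using subsetD[OF S(1) ij] subsetD[OF S(1) kl] assms(3) by auto
    have eq: "i1 = k \<longleftrightarrow> j1 = l"
      using inj_onD[OF S(2) _ ij kl] inj_onD[OF S(3) _ ij kl] by auto
    have "swp i1 j1 \<circ> swp k l = swp k l \<circ> swp i1 j1"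
      using ne eq by (auto simp: fun_eq_iff Transposition.transpose_def)
    then show "act_in k l flip \<circ> act_in i1 j1 flip =
               act_in i1 j1 flip \<circ> (act_in k l flip :: 'a tensor \<Rightarrow> 'a tensor)"
      using ne by (intro ext) (simp add: act_in_flip comp_assoc)
  qed
  have "i \<noteq> j" using S(1) assms(3) by auto
  then show ?thesis
    using fold_insert[of "(i, j)" S T] assms by (simp add: flip_prod_def act_in_flip)
qed

text \<open>Conjugation by \<open>f\<close> relabels every flip, and the remaining \<open>f\<close>
  reaches \<open>T\<close>, where it costs a sign. Both \<open>S\<close> and its image are
  matchings, so either fold can be unfolded pair by pair.\<close>

lemma flip_prod_equivariant:
  fixes T :: "'n::finite tensor"
  assumes "S \<in> matchings A B" "map_prod f f ` S \<in> matchings A B" "A \<inter> B = {}" "finite S" "bij f"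
    and "\<And>I. T (I \<circ> f) = - T I"
  shows "flip_prod S T (I \<circ> f) = - flip_prod (map_prod f f ` S) T I"
  using assms(4,1,2)
proof (induction S arbitrary: I rule: finite_induct)
  case empty
  show ?case unfolding image_empty flip_prod_empty by (rule assms(6))
next
  case (insert x S)
  obtain i j where x: "x = (i, j)" by fastforce
  have inj: "inj (map_prod f f)"
    using assms(5) by (simp add: bij_def prod.inj_map)
  have "flip_prod (insert x S) T (I \<circ> f) = flip_prod S T (I \<circ> f \<circ> swp i j)"
    using flip_prod_insert[of i j S A B T] insert assms(3) by (simp add: x)
  also have "I \<circ> f \<circ> swp i j = I \<circ> swp (f i) (f j) \<circ> f"
    using assms(5) by (simp add: comp_assoc swp_comp_bij)
  also have "flip_prod S T (I \<circ> swp (f i) (f j) \<circ> f) =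
      - flip_prod (map_prod f f ` S) T (I \<circ> swp (f i) (f j))"
    using insert.prems by (intro insert.IH) (auto elim: matchings_subset)
  also have "flip_prod (map_prod f f ` S) T (I \<circ> swp (f i) (f j)) =
      flip_prod (map_prod f f ` (insert x S)) T I"
  proof -
    have "(f i, f j) \<notin> map_prod f f ` S"
      using insert.hyps(2) x inj by (metis inj_image_mem_iff map_prod_simp)
    then show ?thesis
      using flip_prod_insert[of "f i" "f j" "map_prod f f ` S" A B T] insert assms(3)
      by (simp add: x)
  qed
  finally show ?case .
qed

text \<open>Since \<open>swp r q \<circ> swp i q = swp i q \<circ> swp r i\<close>, the flip at the
  matched \<open>q\<close> becomes one inside \<open>insert r A\<close>; it passes the other pairs,
  which avoid \<open>r\<close> and \<open>i\<close>, and gives the sign at \<open>T\<close>.\<close>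

lemma flip_prod_absorb:
  assumes "S \<in> matchings A B" "insert r A \<inter> B = {}" "finite S"
    and "antisymmetric_in (insert r A) T" "r \<notin> A" "(i, q) \<in> S"
  shows "flip_prod S T (I \<circ> swp r q) = - flip_prod S T I"
proof -
  define S' where "S' = S - {(i, q)}"
  have S: "S = insert (i, q) S'" "(i, q) \<notin> S'" using assms(6) by (auto simp: S'_def)
  have AB: "A \<inter> B = {}" using assms(2) by auto
  have finS': "finite S'" using assms(3) by (simp add: S'_def)
  have m: "insert (i, q) S' \<in> matchings A B" using S assms by simp
  have iq: "i \<in> A" "q \<in> B" using assms(1,6) by (auto simp: matchings_def)
  have ne: "i \<noteq> q" "r \<noteq> q" "r \<noteq> i" using iq assms by auto
  have fix': "map_prod (swp r i) (swp r i) x = x" if "x \<in> S'" for x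
  proof -
    obtain k l where x: "x = (k, l)" by fastforce
    have "k \<in> A" "l \<in> B" using that m x by (auto simp: matchings_def)
    moreover have "k \<noteq> i"
      using m that x S(2) by (auto simp: matchings_def inj_on_def)
    ultimately show ?thesis
      using assms(2,5) iq AB x by (auto simp: Transposition.transpose_def)
  qed
  then have im: "map_prod (swp r i) (swp r i) ` S' = S'" by force
  have m': "S' \<in> matchings A B" using m by (rule matchings_subset) auto
  have "flip_prod S T (I \<circ> swp r q) = flip_prod S' T (I \<circ> swp r q \<circ> swp i q)"
    using fun_cong[OF flip_prod_insert[OF m S(2) AB finS'], of T] unfolding S(1) .
  also have "swp r q \<circ> swp i q = swp i q \<circ> swp r i"
    using ne by (auto simp: fun_eq_iff Transposition.transpose_def)
  then have "I \<circ> swp r q \<circ> swp i q = I \<circ> swp i q \<circ> swp r i"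
    by (simp add: comp_assoc)
  also have "flip_prod S' T (I \<circ> swp i q \<circ> swp r i) = - flip_prod S' T (I \<circ> swp i q)"
    using flip_prod_equivariant[of S' A B "swp r i" T "I \<circ> swp i q"] m' im AB assms(3) ne iq
      antisymmetric_inD[OF assms(4), of r i]
    by (simp add: S'_def)
  also have "flip_prod S' T (I \<circ> swp i q) = flip_prod S T I"
    using fun_cong[OF flip_prod_insert[OF m S(2) AB finS', symmetric]] unfolding S(1) .
  finally show ?thesis .
qed

lemma matchings_insert:
  assumes "r \<notin> A"
  shows "matchings (insert r A) B =
    matchings A B \<union> (\<lambda>(S, q). insert (r, q) S) ` (SIGMA S:matchings A B. B - snd ` S)"
    (is "_ = _ \<union> ?g ` _")
proof (intro equalityI subsetI)
  fix S assume S: "S \<in> matchings (insert r A) B"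
  show "S \<in> matchings A B \<union> ?g ` (SIGMA S:matchings A B. B - snd ` S)"
  proof (cases "\<exists>q. (r, q) \<in> S")
    case False
    then show ?thesis using S by (auto simp: matchings_def)
  next
    case True
    then obtain q where q: "(r, q) \<in> S" by auto
    have "S - {(r, q)} \<in> matchings A B"
      using S q by (fastforce simp: matchings_def inj_on_def)
    moreover have "q \<in> B - snd ` (S - {(r, q)})"
      using S q by (fastforce simp: matchings_def inj_on_def)
    ultimately have "?g (S - {(r, q)}, q) \<in> ?g ` (SIGMA S:matchings A B. B - snd ` S)"
      by (intro imageI) auto
    moreover have "?g (S - {(r, q)}, q) = S" using q by auto
    ultimately show ?thesis by simp
  qed
next
  fix S assume "S \<in> matchings A B \<union> ?g ` (SIGMA S:matchings A B. B - snd ` S)"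
  then show "S \<in> matchings (insert r A) B"
  proof
    assume "S \<in> ?g ` (SIGMA S:matchings A B. B - snd ` S)"
    then obtain S' q where S: "S = insert (r, q) S'" and S': "S' \<in> matchings A B"
      and q: "q \<in> B" "q \<notin> snd ` S'"
      by auto
    have "r \<notin> fst ` S'" using S' assms by (auto simp: matchings_def)
    then have "r \<notin> fst ` (S' - {(r, q)})" "q \<notin> snd ` (S' - {(r, q)})" using q by auto
    then show ?thesis using S' q by (auto simp: S matchings_def)
  qed (auto simp: matchings_def)
qed

text \<open>No member of \<open>matchings A B\<close> involves \<open>r\<close>, so matchings with
  and without \<open>r\<close> are disjoint kinds, and \<open>insert (r, q) S\<close> determines
  both \<open>S\<close> and \<open>q\<close>.\<close>

lemma sum_matchings_insert:
  assumes "r \<notin> A" "finite A" "finite B"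
  shows "sum f (matchings (insert r A) B) =
    (\<Sum>S\<in>matchings A B. f S + (\<Sum>q\<in>B - snd ` S. f (insert (r, q) S)))"
proof -
  let ?g = "\<lambda>(S, q). insert (r, q) S"
  let ?D = "SIGMA S:matchings A B. B - snd ` S"
  have no_r: "(r, q) \<notin> S" if "S \<in> matchings A B" for S q
    using that assms(1) by (auto simp: matchings_def)
  have inj: "inj_on ?g ?D"
  proof (rule inj_onI, clarsimp)
    fix S q S' q'
    assume m: "S \<in> matchings A B" "S' \<in> matchings A B"
      and eq: "insert (r, q) S = insert (r, q') S'"
    have "(r, q) \<in> insert (r, q') S'" using eq by blast
    then have "q = q'" using no_r[OF m(2)] by auto
    moreover have "S = S'"
      using eq no_r[OF m(1)] no_r[OF m(2)] \<open>q = q'\<close> by (simp add: insert_ident)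
    ultimately show "S = S' \<and> q = q'" by simp
  qed
  have "sum f (matchings (insert r A) B) = sum f (matchings A B) + sum f (?g ` ?D)"
    unfolding matchings_insert[OF assms(1)] using no_r assms
    by (intro sum.union_disjoint finite_imageI finite_SigmaI finite_matchings) auto
  also have "sum f (?g ` ?D) = (\<Sum>S\<in>matchings A B. \<Sum>q\<in>B - snd ` S. f (insert (r, q) S))"
    unfolding sum.reindex[OF inj] using assms
    by (simp add: sum.Sigma finite_matchings) (simp add: comp_def case_prod_unfold)
  finally show ?thesis by (simp add: sum.distrib)
qed

section \<open>Weighted sums over matchings\<close>

text \<open>The reciprocal of the falling factorial \<open>w (w - 1) ... (w - d + 1)\<close>. The
  index starts at 0, whence a shift by one against the products in
  \<open>pair_factor\<close>.\<close>

definition matching_coeff :: "complex \<Rightarrow> nat \<Rightarrow> complex" where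
  "matching_coeff w d = (\<Prod>k<d. 1 / (w - of_nat k))"

lemma matching_coeff_Suc: "matching_coeff w (Suc d) = matching_coeff (w - 1) d / w"
  unfolding matching_coeff_def prod.lessThan_Suc_shift by (simp add: algebra_simps)

text \<open>The first or the last factor of \<open>matching_coeff w (Suc d)\<close> is split off,
  and the results are compared. The correction \<open>1 - d/w\<close> will account for the
  \<open>d\<close> positions of \<open>B\<close> already matched.\<close>

lemma matching_coeff_pred:
  assumes "w \<notin> \<int>"
  shows "matching_coeff w d = matching_coeff (w - 1) d * (1 - of_nat d / w)"
proof -
  have "w - of_nat d \<noteq> 0" "w \<noteq> 0" using assms by auto
  moreover have "matching_coeff w (Suc d) = matching_coeff w d / (w - of_nat d)"
    by (simp add: matching_coeff_def)
  ultimately show ?thesis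
    by (simp add: matching_coeff_Suc field_simps)
qed

definition matching_sum :: "nat set \<Rightarrow> nat set \<Rightarrow> complex \<Rightarrow> 'n::finite tensor \<Rightarrow> 'n tensor" where
  "matching_sum A B w T =
     (\<lambda>I. \<Sum>S\<in>matchings A B. matching_coeff w (card S) * flip_prod S T I)"

text \<open>With \<open>w = c - r\<close>, the matched \<open>q\<close> contribute
  \<open>- 1/w\<close> each, in total the factor \<open>1 - card S / w\<close> that changes the
  weight for \<open>w - 1\<close> into that for \<open>w\<close>. Each free \<open>q\<close>
  produces \<open>insert (r, q) S\<close> with the weight of the next size.\<close>

lemma jucys_row_matching_sum:
  assumes "antisymmetric_in (insert r A) T" "insert r A \<inter> B = {}" "r \<notin> A"
    and "finite A" "finite B" "c \<notin> \<int>"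
  shows "jucys_row B c r (matching_sum A B (c - of_nat (Suc r)) T) =
         matching_sum (insert r A) B (c - of_nat r) T"
proof
  fix I
  define w where "w = c - of_nat r"
  have w: "w \<notin> \<int>" using assms(6) by (metis w_def Ints_add Ints_of_nat diff_add_cancel)
  have shift: "c - of_nat (Suc r) = w - 1" by (simp add: w_def)
  have step: "flip_prod S T I + (\<Sum>q\<in>B. flip_prod S T (I \<circ> swp r q)) / w =
      (1 - of_nat (card S) / w) * flip_prod S T I
      + (\<Sum>q\<in>B - snd ` S. flip_prod (insert (r, q) S) T I) / w"
    if S: "S \<in> matchings A B" for S
  proof -
    have fS: "finite S" using S assms matchings_finite by blast
    have sub: "snd ` S \<subseteq> B" using S by (auto simp: matchings_def)
    have "flip_prod S T (I \<circ> swp r q) = - flip_prod S T I" if "q \<in> snd ` S" for q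
      using that flip_prod_absorb[OF S assms(2) fS assms(1,3)] by auto
    then have "(\<Sum>q\<in>snd ` S. flip_prod S T (I \<circ> swp r q)) = (\<Sum>q\<in>snd ` S. - flip_prod S T I)"
      by (intro sum.cong) auto
    also have "\<dots> = - of_nat (card S) * flip_prod S T I"
      using S by (simp add: matchings_def card_image)
    finally have old: "(\<Sum>q\<in>snd ` S. flip_prod S T (I \<circ> swp r q)) = - of_nat (card S) * flip_prod S T I" .
    have new: "flip_prod (insert (r, q) S) T I = flip_prod S T (I \<circ> swp r q)" if "q \<in> B - snd ` S" for q
    proof -
      have "insert (r, q) S \<in> matchings (insert r A) B"
        unfolding matchings_insert[OF assms(3)] using S that by (intro UnI2 image_eqI[where x = "(S, q)"]) auto
      moreover have "(r, q) \<notin> S" using that by force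
      ultimately show ?thesis
        using flip_prod_insert[of r q S "insert r A" B T] assms(2) fS by simp
    qed
    have "(\<Sum>q\<in>B. flip_prod S T (I \<circ> swp r q)) =
      (\<Sum>q\<in>B - snd ` S. flip_prod S T (I \<circ> swp r q)) - of_nat (card S) * flip_prod S T I"
      using sum.subset_diff[OF sub assms(5), of "\<lambda>q. flip_prod S T (I \<circ> swp r q)"] old by simp
    then show ?thesis
      using new by (simp add: diff_divide_distrib left_diff_distrib)
  qed
  have "jucys_row B c r (matching_sum A B (w - 1) T) I =
      (\<Sum>S\<in>matchings A B. matching_coeff (w - 1) (card S) *
        (flip_prod S T I + (\<Sum>q\<in>B. flip_prod S T (I \<circ> swp r q)) / w))"
    unfolding jucys_row_def matching_sum_def w_def [symmetric]
    by (subst sum.swap) (simp add: sum_distrib_left [symmetric] sum.distrib distrib_left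
      flip: sum_divide_distrib)
  also have "\<dots> = (\<Sum>S\<in>matchings A B. matching_coeff w (card S) * flip_prod S T I +
      (\<Sum>q\<in>B - snd ` S. matching_coeff w (card (insert (r, q) S)) * flip_prod (insert (r, q) S) T I))"
  proof (rule sum.cong)
    fix S assume S: "S \<in> matchings A B"
    have fS: "finite S" using S assms matchings_finite by blast
    have "(r, q) \<notin> S" for q using S assms(3) by (auto simp: matchings_def)
    then have "card (insert (r, q) S) = Suc (card S)" for q using fS by simp
    then show "matching_coeff (w - 1) (card S) *
        (flip_prod S T I + (\<Sum>q\<in>B. flip_prod S T (I \<circ> swp r q)) / w) =
      matching_coeff w (card S) * flip_prod S T I +
      (\<Sum>q\<in>B - snd ` S. matching_coeff w (card (insert (r, q) S)) * flip_prod (insert (r, q) S) T I)"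
      unfolding step[OF S] matching_coeff_pred[OF w, of "card S"]
      by (simp add: matching_coeff_Suc distrib_left mult.assoc flip: sum_distrib_left sum_divide_distrib)
  qed simp
  also have "\<dots> = matching_sum (insert r A) B w T I"
    unfolding matching_sum_def sum_matchings_insert[OF assms(3-5)] ..
  finally show "jucys_row B c r (matching_sum A B (c - of_nat (Suc r)) T) I =
      matching_sum (insert r A) B (c - of_nat r) T I"
    unfolding shift w_def [symmetric] .
qed

text \<open>Induction downwards from \<open>e\<close>, since the head \<open>r\<close> is applied
  last: vertices join the matchings in decreasing order, and \<open>c - r\<close> grows by one each
  time.\<close>

lemma ordered_prod_jucys_row:
  assumes "r \<le> e" "antisymmetric_in {r..<e} T" "{r..<e} \<inter> B = {}" "finite B" "c \<notin> \<int>"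
  shows "ordered_prod (jucys_row B c) [r..<e] T = matching_sum {r..<e} B (c - of_nat r) T"
  using assms(1-3)
proof (induction r rule: inc_induct)
  case base
  then show ?case
    by (simp add: matching_sum_def matchings_empty_left matching_coeff_def)
next
  case (step r)
  have ins: "{r..<e} = insert r {Suc r..<e}" using step.hyps by auto
  have "ordered_prod (jucys_row B c) [Suc r..<e] T = matching_sum {Suc r..<e} B (c - of_nat (Suc r)) T"
    by (rule step.IH) (use step.prems in \<open>auto simp: antisymmetric_in_def ins\<close>)
  then have expand: "ordered_prod (jucys_row B c) [r..<e] T =
      jucys_row B c r (matching_sum {Suc r..<e} B (c - of_nat (Suc r)) T)"
    using step.hyps by (simp add: upt_conv_Cons)
  show ?case
    unfolding expand ins
    by (rule jucys_row_matching_sum) (use step.prems assms(4,5) in \<open>simp_all add: ins [symmetric]\<close>)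
qed

text \<open>\<open>C\<close> equals or avoids each of \<open>A\<close> and \<open>B\<close>, so a
  transposition within \<open>C\<close> preserves both. Relabelling by it permutes the matchings,
  keeps their sizes and gives each term the sign.\<close>

lemma antisymmetric_in_matching_sum:
  assumes "antisymmetric_in C T" "A \<inter> B = {}" "finite A" "finite B"
    and "C \<inter> A = {} \<or> C = A" "C \<inter> B = {} \<or> C = B"
  shows "antisymmetric_in C (matching_sum A B w T)"
  unfolding antisymmetric_in_def
proof (intro ballI impI allI)
  fix s t I assume st: "s \<in> C" "t \<in> C" "s \<noteq> t"
  let ?f = "swp s t" and ?F = "(`) (map_prod (swp s t) (swp s t))"
  have memb: "?f x \<in> A" if "x \<in> A" for x
    using st that assms(5) by (auto simp: Transposition.transpose_def)
  have memb': "?f x \<in> B" if "x \<in> B" for x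
    using st that assms(6) by (auto simp: Transposition.transpose_def)
  have inv: "?F (?F S) = S" for S
    by (simp add: image_image map_prod.comp [unfolded comp_def] prod.map_id0 [unfolded id_def])
       (simp add: map_prod_def split_def)
  have inj: "inj (map_prod ?f ?f)"
    by (simp add: prod.inj_map bij_is_inj)
  have F: "?F S \<in> matchings A B" if "S \<in> matchings A B" for S
  proof -
    have "?F S \<subseteq> A \<times> B"
      using that memb memb' by (fastforce simp: matchings_def)
    moreover have "inj_on fst (?F S)" "inj_on snd (?F S)"
      using that by (auto simp: matchings_def inj_on_def transpose_eq_iff)
    ultimately show ?thesis by (simp add: matchings_def)
  qed
  have bij: "bij_betw ?F (matchings A B) (matchings A B)"
    by (rule bij_betw_byWitness[where f' = ?F]) (use inv F in auto)
  have "matching_sum A B w T (I \<circ> ?f) =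
      (\<Sum>S\<in>matchings A B. - (matching_coeff w (card (?F S)) * flip_prod (?F S) T I))"
    unfolding matching_sum_def
  proof (rule sum.cong)
    fix S assume S: "S \<in> matchings A B"
    have "flip_prod S T (I \<circ> ?f) = - flip_prod (?F S) T I"
      using S F antisymmetric_inD[OF assms(1) st] matchings_finite[OF S assms(3,4)] assms(2)
      by (intro flip_prod_equivariant) auto
    moreover have "card (?F S) = card S"
      using inj by (intro card_image) (auto intro: inj_on_subset)
    ultimately show "matching_coeff w (card S) * flip_prod S T (I \<circ> ?f) =
        - (matching_coeff w (card (?F S)) * flip_prod (?F S) T I)"
      by simp
  qed simp
  also have "\<dots> = (\<Sum>S\<in>matchings A B. - (matching_coeff w (card S) * flip_prod S T I))"
    by (rule sum.reindex_bij_betw[OF bij])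
  finally show "matching_sum A B w T (I \<circ> ?f) = - matching_sum A B w T I"
    by (simp add: matching_sum_def sum_negf)
qed

section \<open>Segments\<close>

lemma segment_eq: "segment \<nu> a = {Suc (\<Sum>c=1..<a. \<nu> c)..<Suc (\<Sum>c=1..a. \<nu> c)}"
  by (simp add: segment_list_def del: upt_Suc)

lemma sum_upto_eq: "(a :: nat) \<ge> 1 \<Longrightarrow> (\<Sum>c=1..a. \<nu> c) = (\<Sum>c=1..<a. \<nu> c) + (\<nu> a :: nat)"
  using sum.last_plus[of 1 a \<nu>] by simp

lemma segment_less:
  assumes "a < b" "p \<in> segment \<nu> a" "q \<in> segment \<nu> b"
  shows "p < q"
proof -
  have "(\<Sum>c=1..a. \<nu> c) \<le> (\<Sum>c=1..<b. \<nu> c)"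
    using assms(1) by (intro sum_mono2) auto
  then show ?thesis using assms by (auto simp: segment_eq)
qed

lemma segment_disjoint: "a \<noteq> b \<Longrightarrow> segment \<nu> a \<inter> segment \<nu> b = {}"
  by (metis disjoint_iff less_irrefl linorder_neqE_nat segment_less)

lemma segment_of_eq:
  assumes "p \<in> segment \<nu> a"
  shows "segment_of \<nu> p = a"
  unfolding segment_of_def
proof (rule Least_equality)
  show "p \<le> (\<Sum>c=1..a. \<nu> c)" using assms by (simp add: segment_eq)
next
  fix b assume b: "p \<le> (\<Sum>c=1..b. \<nu> c)"
  show "a \<le> b"
  proof (rule ccontr)
    assume "\<not> a \<le> b"
    then have "(\<Sum>c=1..b. \<nu> c) \<le> (\<Sum>c=1..<a. \<nu> c)"
      by (intro sum_mono2) auto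
    then show False using assms b by (simp add: segment_eq)
  qed
qed

lemma x_coord_eq:
  assumes "p \<in> segment \<nu> a"
  shows "x_coord m \<nu> \<mu> p =
    \<mu> a + rho m a + 1 / 2 + of_nat (\<nu> a) - (of_nat p - of_nat (\<Sum>c=1..<a. \<nu> c))"
  using assms
  by (simp add: x_coord_def Let_def position_in_segment_def segment_of_eq segment_eq of_nat_diff del: of_nat_sum)

lemma upt_append: "i \<le> j \<Longrightarrow> j \<le> k \<Longrightarrow> [i..<j] @ [j..<k] = [i..<k]"
  using upt_add_eq_append[of i j "k - j"] by simp

lemma upt_total_eq: "[1..<Suc (total m \<nu>)] = concat (map (segment_list \<nu>) [1..<Suc m])"
proof (induction m)
  case 0
  then show ?case by (simp add: total_def)
next
  case (Suc m)
  have le: "Suc (\<Sum>c=1..m. \<nu> c) \<le> Suc (\<Sum>c=1..Suc m. \<nu> c)" by simp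
  have "[1..<Suc (total (Suc m) \<nu>)] = [1..<Suc (total m \<nu>)] @ segment_list \<nu> (Suc m)"
    unfolding total_def segment_list_def
    using upt_append[OF _ le, of 1] by (simp add: atLeastLessThanSuc_atLeastAtMost del: upt_Suc)
  then show ?case using Suc by simp
qed

section \<open>Regrouping the factors into blocks\<close>

lemma concat_concat_map: "concat (concat (map f xs)) = concat (map (\<lambda>x. concat (f x)) xs)"
  by (induction xs) simp_all

text \<open>The filter rejects earlier segments by \<open>p < q\<close> and the segment of
  \<open>p\<close> itself by \<open>segment_of\<close>; later segments survive whole.\<close>

lemma B_pairs_row:
  assumes "a \<in> {1..m}" "p \<in> segment \<nu> a"
  shows "concat (map (\<lambda>q. if p < q \<and> segment_of \<nu> p \<noteq> segment_of \<nu> q then [(p, q)] else [])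
           (reversed_within_segments m \<nu>)) =
         concat (map (\<lambda>b. map (Pair p) (rev (segment_list \<nu> b))) [Suc a..<Suc m])"
proof -
  let ?g = "\<lambda>q. if p < q \<and> segment_of \<nu> p \<noteq> segment_of \<nu> q then [(p, q)] else []"
  let ?h = "\<lambda>b. concat (map ?g (rev (segment_list \<nu> b)))"
  have sp: "segment_of \<nu> p = a" using assms by (simp add: segment_of_eq)
  have split: "[1..<Suc m] = [1..<Suc a] @ [Suc a..<Suc m]"
    using assms(1) by (intro upt_append [symmetric]) auto
  have "concat (map ?g (reversed_within_segments m \<nu>)) = concat (map ?h [1..<Suc m])"
    by (simp add: reversed_within_segments_def map_concat comp_def concat_concat_map del: upt_Suc)
  also have "\<dots> = concat (map ?h [1..<Suc a]) @ concat (map ?h [Suc a..<Suc m])"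
    unfolding split by simp
  also have "concat (map ?h [1..<Suc a]) = []"
  proof -
    have "\<not> p < q" if "b < a" "q \<in> segment \<nu> b" for b q
      using segment_less[OF that assms(2)] by simp
    then have "?g q = []" if "b \<in> set [1..<Suc a]" "q \<in> segment \<nu> b" for b q
    proof (cases "b = a")
      case True
      then show ?thesis using sp segment_of_eq[OF that(2)] by simp
    next
      case False
      then have "b < a" using that(1) by (auto simp del: upt_Suc)
      then show ?thesis using segment_less[OF _ that(2) assms(2)] by auto
    qed
    then have "?h b = []" if "b \<in> set [1..<Suc a]" for b
      using that unfolding concat_eq_Nil_conv by (auto simp del: upt_Suc)
    then show ?thesis by (simp del: upt_Suc)
  qed
  also have "map ?h [Suc a..<Suc m] = map (\<lambda>b. map (Pair p) (rev (segment_list \<nu> b))) [Suc a..<Suc m]"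
  proof (rule map_cong)
    fix b assume b: "b \<in> set [Suc a..<Suc m]"
    have "map ?g (rev (segment_list \<nu> b)) = map (\<lambda>q. [(p, q)]) (rev (segment_list \<nu> b))"
      using segment_less[OF _ assms(2), of b] b sp segment_of_eq[of _ \<nu> b]
      by (intro map_cong) (auto simp del: upt_Suc)
    then show "?h b = map (Pair p) (rev (segment_list \<nu> b))"
      by (metis concat_map_singleton)
  qed simp
  finally show ?thesis by simp
qed

text \<open>One row of a block: \<open>p\<close> is fixed and the second index runs through the
  segment \<open>b\<close>, largest leftmost, the order used in \<open>row_product\<close>.\<close>

definition row_op ::
    "nat \<Rightarrow> (nat \<Rightarrow> nat) \<Rightarrow> (nat \<Rightarrow> complex) \<Rightarrow> nat \<Rightarrow> nat \<Rightarrow> 'n::finite tensor \<Rightarrow> 'n tensor" where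
  "row_op m \<nu> \<mu> p b =
     ordered_prod (\<lambda>q. act_in p q (R_matrix (x_coord m \<nu> \<mu> q - x_coord m \<nu> \<mu> p)))
       (rev (segment_list \<nu> b))"

lemma row_op_commute:
  assumes "p \<noteq> p'" "b \<noteq> b'" "p \<in> segment \<nu> a" "p' \<in> segment \<nu> a" "a \<noteq> b" "a \<noteq> b'"
  shows "row_op m \<nu> \<mu> p b \<circ> row_op m \<nu> \<mu> p' b' = row_op m \<nu> \<mu> p' b' \<circ> row_op m \<nu> \<mu> p b"
proof -
  have "act_in p q (R_matrix x) \<circ> act_in p' q' (R_matrix y) =
      act_in p' q' (R_matrix y) \<circ> act_in p q (R_matrix x)"
    if "q \<in> segment \<nu> b" "q' \<in> segment \<nu> b'" for q q' x y
    using that assms segment_disjoint[of a b \<nu>] segment_disjoint[of a b' \<nu>] segment_disjoint[of b b' \<nu>]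
    by (intro act_in_R_matrix_commute) auto
  then show ?thesis
    unfolding row_op_def by (intro ordered_prod_commute ordered_prod_commute [symmetric]) auto
qed

lemma B_op_eq:
  "B_op m \<nu> \<mu> =
     ordered_prod (\<lambda>(a, b). ordered_prod (\<lambda>p. row_op m \<nu> \<mu> p b) (segment_list \<nu> a)) (lex_pairs m)"
proof -
  let ?F = "\<lambda>(p, q). act_in p q (R_matrix (x_coord m \<nu> \<mu> q - x_coord m \<nu> \<mu> p))"
  let ?c = "\<lambda>p. concat (map (\<lambda>q. if p < q \<and> segment_of \<nu> p \<noteq> segment_of \<nu> q then [(p, q)] else [])
           (reversed_within_segments m \<nu>))"
  have "B_op m \<nu> \<mu> = ordered_prod (\<lambda>a. ordered_prod (\<lambda>p. ordered_prod ?F (?c p)) (segment_list \<nu> a)) [1..<Suc m]"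
    unfolding B_op_def B_pairs_def upt_total_eq by (simp add: ordered_prod_concat_map del: upt_Suc)
  also have "\<dots> = ordered_prod (\<lambda>a. ordered_prod (\<lambda>b. ordered_prod (\<lambda>p. row_op m \<nu> \<mu> p b) (segment_list \<nu> a))
      [Suc a..<Suc m]) [1..<Suc m]"
  proof (rule ordered_prod_cong)
    fix a assume a: "a \<in> set [1..<Suc m]"
    have "ordered_prod (\<lambda>p. ordered_prod ?F (?c p)) (segment_list \<nu> a) =
        ordered_prod (\<lambda>p. ordered_prod (row_op m \<nu> \<mu> p) [Suc a..<Suc m]) (segment_list \<nu> a)"
    proof (rule ordered_prod_cong)
      fix p assume "p \<in> segment \<nu> a"
      then have "?c p = concat (map (\<lambda>b. map (Pair p) (rev (segment_list \<nu> b))) [Suc a..<Suc m])"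
        using a by (intro B_pairs_row) auto
      then show "ordered_prod ?F (?c p) = ordered_prod (row_op m \<nu> \<mu> p) [Suc a..<Suc m]"
        by (simp only: ordered_prod_concat_map ordered_prod_map row_op_def [abs_def] prod.case)
    qed
    \<comment> \<open>Within one segment \<open>a\<close> the product over later segments moves
      outside the product over \<open>p\<close>, which yields the lexicographic order of
      blocks.\<close>
    also have "\<dots> = ordered_prod (\<lambda>b. ordered_prod (\<lambda>p. row_op m \<nu> \<mu> p b) (segment_list \<nu> a)) [Suc a..<Suc m]"
    proof (rule ordered_prod_swap)
      show "distinct (segment_list \<nu> a)" "distinct [Suc a..<Suc m]"
        by (simp_all add: segment_list_def del: upt_Suc)
    qed (rule row_op_commute[where a = a], auto)
    finally show "ordered_prod (\<lambda>p. ordered_prod ?F (?c p)) (segment_list \<nu> a) =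
        ordered_prod (\<lambda>b. ordered_prod (\<lambda>p. row_op m \<nu> \<mu> p b) (segment_list \<nu> a)) [Suc a..<Suc m]" .
  qed
  also have "\<dots> = ordered_prod (\<lambda>(a, b). ordered_prod (\<lambda>p. row_op m \<nu> \<mu> p b) (segment_list \<nu> a)) (lex_pairs m)"
    unfolding lex_pairs_def by (simp add: ordered_prod_concat_map ordered_prod_map comp_def del: upt_Suc)
  finally show ?thesis .
qed

section \<open>Blocks as pair factors\<close>

text \<open>Matchings are grouped by size: size 0 gives the identity, and the final
  \<open>- 1\<close> in the parameter matches the factor with \<open>k = 1\<close>.\<close>

lemma pair_factor_eq:
  assumes "1 \<le> a" "a < b"
  shows "pair_factor m \<nu> lam a b T =
    matching_sum (segment \<nu> a) (segment \<nu> b)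
      (lam a - lam b + rho m a - rho m b + of_nat (\<nu> b) - 1) T"
proof
  fix I
  let ?z = "lam a - lam b + rho m a - rho m b + of_nat (\<nu> b)"
  let ?M = "matchings (segment \<nu> a) (segment \<nu> b)" and ?D = "min (\<nu> a) (\<nu> b)"
  let ?f = "\<lambda>S. matching_coeff (?z - 1) (card S) * flip_prod S T I"
  have fin: "finite ?M" by (intro finite_matchings) auto
  have ps: "{S \<in> ?M. card S = d} = pair_sets \<nu> a b d" for d
    by (auto simp: matchings_def pair_sets_def)
  have coeff: "matching_coeff (?z - 1) d = (\<Prod>k=1..d. 1 / (?z - of_nat k))" for d
    unfolding matching_coeff_def
    by (rule prod.reindex_bij_witness[where i = "\<lambda>k. k - 1" and j = Suc]) (auto simp: algebra_simps)
  \<comment> \<open>By \<open>pair_sets_empty\<close> no matching is larger than the shorter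
    segment.\<close>
  have "card ` ?M \<subseteq> {0..?D}"
    using ps pair_sets_empty[of a b \<nu>] assms by (fastforce simp: not_le [symmetric])
  then have "sum ?f ?M = (\<Sum>d=0..?D. sum ?f {S \<in> ?M. card S = d})"
    by (intro sum.group [symmetric] fin) auto
  also have "\<dots> = sum ?f (pair_sets \<nu> a b 0) + (\<Sum>d=1..?D. sum ?f (pair_sets \<nu> a b d))"
    by (simp add: ps sum.atLeast_Suc_atMost)
  also have "pair_sets \<nu> a b 0 = {{}}"
  proof -
    have "finite S" if "S \<subseteq> segment \<nu> a \<times> segment \<nu> b" for S
      using that by (rule finite_subset) auto
    then show ?thesis by (auto simp: pair_sets_def)
  qed
  also have "(\<Sum>d=1..?D. sum ?f (pair_sets \<nu> a b d)) =
      (\<Sum>d=1..?D. \<Sum>S\<in>pair_sets \<nu> a b d. (\<Prod>k=1..d. 1 / (?z - of_nat k)) * flip_prod S T I)"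
    by (intro sum.cong) (auto simp: pair_sets_def coeff)
  finally show "pair_factor m \<nu> lam a b T I = matching_sum (segment \<nu> a) (segment \<nu> b) (?z - 1) T I"
    by (simp add: pair_factor_def matching_sum_def coeff)
qed

text \<open>All rows become \<open>jucys_row\<close> with a common \<open>c\<close>, and their
  product is a matching sum. The terms \<open>\<nu>\<close> in the coordinates
  \<open>x_coord\<close> turn \<open>\<mu>\<close> into \<open>lam\<close>.\<close>

lemma segment_block_eq_pair_factor:
  fixes T :: "'n::finite tensor"
  assumes "1 \<le> a" "a < b" "\<mu> a - \<mu> b \<notin> \<int>"
    and lam: "lam a = \<mu> a + of_nat (\<nu> a)" "lam b = \<mu> b + of_nat (\<nu> b)"
    and T: "antisymmetric_in (segment \<nu> a) T" "antisymmetric_in (segment \<nu> b) T"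
  shows "ordered_prod (\<lambda>p. row_op m \<nu> \<mu> p b) (segment_list \<nu> a) T = pair_factor m \<nu> lam a b T"
proof -
  let ?A = "segment \<nu> a" and ?B = "segment \<nu> b"
  define sa where "sa = (\<Sum>c=1..<a. \<nu> c)"
  define sb where "sb = (\<Sum>c=1..<b. \<nu> c)"
  define z where "z = lam a - lam b + rho m a - rho m b"
  \<comment> \<open>This is \<open>d + e - 1 + p\<close> for the \<open>d\<close> defined below and
    \<open>e = sb + \<nu> b + 1\<close>; there \<open>p\<close> cancels.\<close>
  define c where "c = z + of_nat (\<nu> b) + of_nat sa"
  have la: "segment_list \<nu> a = [Suc sa..<Suc (sa + \<nu> a)]"
    using sum_upto_eq[of a \<nu>] assms(1) by (simp add: segment_list_def sa_def del: upt_Suc)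
  have lb: "segment_list \<nu> b = [Suc sb..<Suc (sb + \<nu> b)]"
    using sum_upto_eq[of b \<nu>] assms(1,2) by (simp add: segment_list_def sb_def del: upt_Suc)
  have A: "?A = {Suc sa..<Suc (sa + \<nu> a)}" and B: "?B = {Suc sb..<Suc (sb + \<nu> b)}"
    unfolding la lb by (simp_all del: upt_Suc)
  have disj: "?A \<inter> ?B = {}" using assms(2) by (intro segment_disjoint) simp
  \<comment> \<open>\<open>z\<close> differs from \<open>\<mu> a - \<mu> b\<close> by an integer, so
    genericity carries over.\<close>
  have nonint: "z + of_int k \<notin> \<int>" for k
  proof
    assume "z + of_int k \<in> \<int>"
    moreover have "\<mu> a - \<mu> b = z + of_int k - of_int (k + int (\<nu> a) - int (\<nu> b) + int b - int a)"
      by (simp add: z_def lam rho_def)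
    ultimately show False using assms(3) by (metis Ints_diff Ints_of_int)
  qed
  have row: "row_op m \<nu> \<mu> p b U = jucys_row ?B c p U"
    if p: "p \<in> ?A" and U: "antisymmetric_in ?B U" for p and U :: "'n tensor"
  proof -
    \<comment> \<open>Read off from the requirement that the difference of coordinates be
      \<open>- (d + q)\<close>.\<close>
    define d where "d = z - (of_nat p - of_nat sa) - of_nat sb"
    have d: "d \<notin> \<int>"
      using nonint[of "int sa - int p - int sb"] by (simp add: d_def algebra_simps)
    have x: "x_coord m \<nu> \<mu> q - x_coord m \<nu> \<mu> p = - (d + of_nat q)" if "q \<in> ?B" for q
      unfolding x_coord_eq[OF that] x_coord_eq[OF p] sa_def [symmetric] sb_def [symmetric] d_def z_def
      by (simp add: lam)
    have "row_op m \<nu> \<mu> p b U =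
        ordered_prod (\<lambda>q. act_in p q (R_matrix (- (d + of_nat q)))) (rev (segment_list \<nu> b)) U"
      unfolding row_op_def using x by (auto intro!: fun_cong[OF ordered_prod_cong])
    also have "\<dots> = (\<lambda>I. U I + (\<Sum>q\<in>?B. U (I \<circ> swp p q)) / (d + of_nat (Suc (sb + \<nu> b)) - 1))"
      unfolding B unfolding lb
      by (rule row_product) (use U p disj d in \<open>auto simp: B simp del: upt_Suc\<close>)
    also have "d + of_nat (Suc (sb + \<nu> b)) - 1 = c - of_nat p"
      by (simp add: d_def c_def)
    finally show ?thesis unfolding jucys_row_def .
  qed
  have c: "c \<notin> \<int>"
    using nonint[of "int (\<nu> b) + int sa"] by (simp add: c_def algebra_simps)
  \<comment> \<open>Rows were identified on tensors antisymmetric in \<open>?B\<close>, a property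
    that \<open>jucys_row\<close> preserves.\<close>
  have "ordered_prod (\<lambda>p. row_op m \<nu> \<mu> p b) (segment_list \<nu> a) T =
      ordered_prod (jucys_row ?B c) (segment_list \<nu> a) T"
    using row T(2) disj
    by (intro ordered_prod_cong_invariant[where Q = "antisymmetric_in ?B"] antisymmetric_in_jucys_row) auto
  also have "\<dots> = matching_sum ?A ?B (c - of_nat (Suc sa)) T"
    unfolding A unfolding la
    by (rule ordered_prod_jucys_row) (use T(1) disj c in \<open>auto simp: A simp del: upt_Suc\<close>)
  also have "c - of_nat (Suc sa) = z + of_nat (\<nu> b) - 1"
    by (simp add: c_def)
  finally show ?thesis
    unfolding pair_factor_eq[OF assms(1,2)] z_def .
qed

theorem proposition2p6:
  fixes m :: nat and \<nu> :: "nat \<Rightarrow> nat" and \<mu> lam :: "nat \<Rightarrow> complex"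
  assumes "CARD('n::finite) \<ge> 2"
    and "m \<ge> 1"
    and "\<forall>a\<in>{1..m}. \<nu> a \<in> {1..CARD('n) - 1}"
    and "\<forall>a\<in>{1..m}. \<forall>b\<in>{1..m}. a \<noteq> b \<longrightarrow> \<mu> a - \<mu> b \<notin> \<int>"
    and "\<forall>a\<in>{1..m}. lam a = \<mu> a + of_nat (\<nu> a)"
  shows "\<forall>T \<in> (antisymmetric_tensors m \<nu> :: 'n tensor set).
           B_op m \<nu> \<mu> T = ordered_prod (\<lambda>(a, b). pair_factor m \<nu> lam a b) (lex_pairs m) T"
proof
  fix T :: "'n tensor" assume T: "T \<in> antisymmetric_tensors m \<nu>"
  \<comment> \<open>Antisymmetry in all segments at once is the invariant, since the remaining
    blocks involve other pairs of segments.\<close>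
  let ?Q = "\<lambda>U :: 'n tensor. \<forall>c\<in>{1..m}. antisymmetric_in (segment \<nu> c) U"
  have Q: "?Q T"
    using T by (auto simp: antisymmetric_tensors_def antisymmetric_in_def act_in_flip fun_eq_iff)
  show "B_op m \<nu> \<mu> T = ordered_prod (\<lambda>(a, b). pair_factor m \<nu> lam a b) (lex_pairs m) T"
    unfolding B_op_eq
  proof (rule ordered_prod_cong_invariant[where Q = ?Q])
    fix x and U :: "'n tensor" assume "x \<in> set (lex_pairs m)" and U: "?Q U"
    then obtain a b where x: "x = (a, b)" and ab: "1 \<le> a" "a < b" "b \<le> m"
      by (auto simp: lex_pairs_def simp del: upt_Suc)
    show "(case x of (a, b) \<Rightarrow> ordered_prod (\<lambda>p. row_op m \<nu> \<mu> p b) (segment_list \<nu> a)) U =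
        (case x of (a, b) \<Rightarrow> pair_factor m \<nu> lam a b) U"
      unfolding x prod.case using ab U assms(4,5) by (intro segment_block_eq_pair_factor) auto
    have "antisymmetric_in (segment \<nu> c) (pair_factor m \<nu> lam a b U)" if "c \<in> {1..m}" for c
    proof -
      have "segment \<nu> c \<inter> segment \<nu> e = {} \<or> segment \<nu> c = segment \<nu> e" for e
        using segment_disjoint[of c e \<nu>] by (cases "c = e") auto
      then show ?thesis
        unfolding pair_factor_eq[OF ab(1,2)] using that U ab segment_disjoint[of a b \<nu>]
        by (intro antisymmetric_in_matching_sum) auto
    qed
    then show "?Q ((case x of (a, b) \<Rightarrow> pair_factor m \<nu> lam a b) U)"
      by (simp add: x)
  qed (rule Q)
qed

end
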